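(* Let $T$ be a bounded linear operator on a complex Banach space $X$ such that $0 \in \operatorname{int} \eta(\sigma(T))$, and suppose that there is a spanning set $S \subseteq X$ such that $r(x,T) < d(0, \partial \eta(\sigma(T)))$ for every $x \in S$. Then the operator $T$ is strongly compact.
   Context: $\sigma(T)$ denotes the spectrum of $T$. If $G$ is the unbounded connected component of $\mathbb{C} \setminus \sigma(T)$, the full spectrum of $T$ is $\eta(\sigma(T)) = \mathbb{C} \setminus G$; $\operatorname{int}$ and $\partial$ denote interior and boundary in $\mathbb{C}$, and $d(0, \partial \eta(\sigma(T))) = \min\{|\lambda| : \lambda \in \partial \eta(\sigma(T))\}$. The local spectral radius of $T$ at $x \in X$ is $r(x,T) = \limsup_{n \to \infty} \|T^n x\|^{1/n}$. A subset $S \subseteq X$ is a spanning set if its linear span is dense in $X$. Let $\mathcal{B}(X)$ be the algebra of bounded linear operators on $X$. A subalgebra $\mathcal{R} \subseteq \mathcal{B}(X)$ is strongly compact if its unit ball $\{R \in \mathcal{R} : \|R\| \leq 1\}$ is precompact (i.e., has compact closure) in the strong operator topology of $\mathcal{B}(X)$. An operator $T \in \mathcal{B}(X)$ is strongly compact if the algebra with identity generated by $T$, namely $\{p(T) : p \text{ a complex polynomial}\}$, is strongly compact. *)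

theory Defs
  imports "HOL-Analysis.Analysis" "HOL-Computational_Algebra.Polynomial"
begin

text \<open>
  The distribution only provides real Banach spaces.  A complex Banach space is a real one whose
  real scalar multiplication extends to a complex scalar multiplication with respect to which the
  norm is absolutely homogeneous.
\<close>

class scaleC =
  fixes scaleC :: "complex \<Rightarrow> 'a \<Rightarrow> 'a"  (infixr "*\<^sub>C" 75)

class complex_vector = real_vector + scaleC +
  assumes scaleC_add_right: "a *\<^sub>C (x + y) = a *\<^sub>C x + a *\<^sub>C y"
    and scaleC_add_left: "(a + b) *\<^sub>C x = a *\<^sub>C x + b *\<^sub>C x"
    and scaleC_scaleC: "a *\<^sub>C (b *\<^sub>C x) = (a * b) *\<^sub>C x"
    and scaleR_scaleC: "r *\<^sub>R x = complex_of_real r *\<^sub>C x"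

class complex_normed_vector = real_normed_vector + complex_vector +
  assumes norm_scaleC: "norm (a *\<^sub>C x) = cmod a * norm x"

class complex_banach = complex_normed_vector + banach

instantiation complex :: complex_banach
begin
definition scaleC_complex :: "complex \<Rightarrow> complex \<Rightarrow> complex"
  where "scaleC_complex a x = a * x"
instance
  by standard (simp_all add: scaleC_complex_def algebra_simps norm_mult scaleR_conv_of_real)
end

lemma scaleC_one: "1 *\<^sub>C x = (x :: 'a :: complex_vector)"
  using scaleR_scaleC[of 1 x] by simp

lemma vector_space_scaleC: "vector_space (scaleC :: complex \<Rightarrow> 'a \<Rightarrow> 'a :: complex_vector)"
  by unfold_locales (rule scaleC_add_right scaleC_add_left scaleC_scaleC scaleC_one)+

definition cspan :: "'a :: complex_vector set \<Rightarrow> 'a set"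
  where "cspan = module.span scaleC"

definition spanning_set :: "'a :: complex_normed_vector set \<Rightarrow> bool"
  where "spanning_set S \<longleftrightarrow> closure (cspan S) = UNIV"

lemma bounded_linear_scaleC: "bounded_linear (\<lambda>x :: 'a :: complex_normed_vector. c *\<^sub>C x)"
proof
  show "c *\<^sub>C (r *\<^sub>R x) = r *\<^sub>R (c *\<^sub>C x)" for r and x :: 'a
    by (simp add: scaleR_scaleC scaleC_scaleC mult.commute)
  show "\<exists>K. \<forall>x :: 'a. norm (c *\<^sub>C x) \<le> norm x * K"
    by (rule exI[of _ "cmod c"]) (simp add: norm_scaleC mult.commute)
qed (rule scaleC_add_right)

instantiation blinfun :: (real_normed_vector, complex_normed_vector) complex_normed_vector
begin

lift_definition scaleC_blinfun :: "complex \<Rightarrow> ('a \<Rightarrow>\<^sub>L 'b) \<Rightarrow> 'a \<Rightarrow>\<^sub>L 'b"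
  is "\<lambda>c f x. c *\<^sub>C f x"
  by (rule bounded_linear_compose[OF bounded_linear_scaleC])

instance
proof
  fix a b :: complex and r :: real and x y :: "'a \<Rightarrow>\<^sub>L 'b"
  show "a *\<^sub>C (x + y) = a *\<^sub>C x + a *\<^sub>C y"
    by transfer (simp add: scaleC_add_right)
  show "(a + b) *\<^sub>C x = a *\<^sub>C x + b *\<^sub>C x"
    by transfer (simp add: scaleC_add_left)
  show "a *\<^sub>C (b *\<^sub>C x) = (a * b) *\<^sub>C x"
    by transfer (simp add: scaleC_scaleC)
  show "r *\<^sub>R x = complex_of_real r *\<^sub>C x"
    by transfer (simp add: scaleR_scaleC)
  show "norm (a *\<^sub>C x) = cmod a * norm x"
  proof transfer
    fix a :: complex and f :: "'a \<Rightarrow> 'b"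
    assume f: "bounded_linear f"
    have "onorm (\<lambda>x. a *\<^sub>C f x) = onorm (\<lambda>x. cmod a *\<^sub>R f x)"
      by (simp add: onorm_def norm_scaleC)
    also have "\<dots> = cmod a * onorm f"
      using onorm_scaleR[OF f, of "cmod a"] by simp
    finally show "onorm (\<lambda>x. a *\<^sub>C f x) = cmod a * onorm f" .
  qed
qed

end

text \<open>
  The type \<open>'a \<Rightarrow>\<^sub>L 'a\<close> consists of the bounded real-linear operators; \<open>bounded_ops\<close> is the algebra
  of the complex-linear ones.  Its norm is the operator norm.
\<close>

definition bounded_ops :: "('a :: complex_normed_vector \<Rightarrow>\<^sub>L 'a) set"
  where "bounded_ops = {T. \<forall>c x. blinfun_apply T (c *\<^sub>C x) = c *\<^sub>C blinfun_apply T x}"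

definition op_power :: "('a :: complex_normed_vector \<Rightarrow>\<^sub>L 'a) \<Rightarrow> nat \<Rightarrow> 'a \<Rightarrow>\<^sub>L 'a"
  where "op_power T n = ((\<lambda>R. T o\<^sub>L R) ^^ n) id_blinfun"

definition op_poly :: "complex poly \<Rightarrow> ('a :: complex_normed_vector \<Rightarrow>\<^sub>L 'a) \<Rightarrow> 'a \<Rightarrow>\<^sub>L 'a"
  where "op_poly p T = (\<Sum>i\<le>degree p. coeff p i *\<^sub>C op_power T i)"

lemma blinfun_apply_op_power: "blinfun_apply (op_power T n) x = (blinfun_apply T ^^ n) x"
  by (induction n) (simp_all add: op_power_def)

lemma blinfun_apply_op_poly:
  "blinfun_apply (op_poly p T) x = (\<Sum>i\<le>degree p. coeff p i *\<^sub>C (blinfun_apply T ^^ i) x)"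
  by (simp add: op_poly_def blinfun.sum_left scaleC_blinfun.rep_eq blinfun_apply_op_power)

definition op_spectrum :: "('a :: complex_normed_vector \<Rightarrow>\<^sub>L 'a) \<Rightarrow> complex set"
  where "op_spectrum T =
    {z. \<not> (\<exists>R\<in>bounded_ops. R o\<^sub>L (T - z *\<^sub>C id_blinfun) = id_blinfun \<and>
                            (T - z *\<^sub>C id_blinfun) o\<^sub>L R = id_blinfun)}"

text \<open>
  \<open>outside K\<close> is the union of the unbounded components of the complement of \<open>K\<close>.  For bounded
  \<open>K\<close>, in particular for a spectrum, there is exactly one such component.
\<close>

definition full_hull :: "complex set \<Rightarrow> complex set"
  where "full_hull K = - outside K"

lemma unbounded_component_iff_outside:
  fixes K :: "complex set"
  assumes "bounded K"
  shows "G \<in> components (- K) \<and> \<not> bounded G \<longleftrightarrow> G = outside K"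
  using assms bounded_unique_outside[of K G] by simp

definition local_spectral_radius :: "'a :: complex_normed_vector \<Rightarrow> ('a \<Rightarrow>\<^sub>L 'a) \<Rightarrow> ereal"
  where "local_spectral_radius x T =
    limsup (\<lambda>n. ereal (root n (norm (blinfun_apply (op_power T n) x))))"

definition SOT :: "('a :: complex_normed_vector \<Rightarrow>\<^sub>L 'a) topology"
  where "SOT = subtopology strong_operator_topology bounded_ops"

definition strongly_compact_algebra :: "('a :: complex_normed_vector \<Rightarrow>\<^sub>L 'a) set \<Rightarrow> bool"
  where "strongly_compact_algebra \<R> \<longleftrightarrow>
    compactin SOT (SOT closure_of {R \<in> \<R>. norm R \<le> 1})"

definition strongly_compact :: "('a :: complex_normed_vector \<Rightarrow>\<^sub>L 'a) \<Rightarrow> bool"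
  where "strongly_compact T \<longleftrightarrow> strongly_compact_algebra (range (\<lambda>p. op_poly p T))"

end

theory Submission
  imports Defs "HOL-Complex_Analysis.Complex_Analysis"
begin

text \<open>
  If \<open>p(T)\<close> has norm at most 1, then \<open>\<bar>p\<bar> \<le> 1\<close> on the spectrum of \<open>T\<close>, hence, by the maximum modulus
  principle, on the full spectrum, which contains every closed disc of radius \<open>r\<close> less than the
  distance \<open>d\<close> of \<open>0\<close> to its boundary.  Cauchy's inequality bounds the coefficients by
  \<open>\<bar>a\<^sub>n\<bar> \<le> r\<^sup>-\<^sup>n\<close>.  If \<open>\<parallel>T\<^sup>n x\<parallel> \<le> s\<^sup>n\<close> eventually, for some \<open>s < r\<close>, then the series \<open>\<Sum> a\<^sub>n T\<^sup>n x\<close> have uniformly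
  small tails, so the orbit of \<open>x\<close> under the unit ball of the algebra is relatively compact.  The
  vectors with relatively compact orbit form a closed subspace, and if every orbit is relatively
  compact, then Tychonoff's theorem gives compactness in the strong operator topology.
\<close>

interpretation scaleC: vector_space "scaleC :: complex \<Rightarrow> 'a \<Rightarrow> 'a :: complex_vector"
  by (rule vector_space_scaleC)

lemma bounded_linear_scaleC_left: "bounded_linear (\<lambda>c. c *\<^sub>C (x :: 'a :: complex_normed_vector))"
proof
  show "(r *\<^sub>R c) *\<^sub>C x = r *\<^sub>R (c *\<^sub>C x)" for r and c :: complex
    by (simp add: scaleR_scaleC scaleC_scaleC scaleC_complex_def)
  show "\<exists>K. \<forall>c. norm (c *\<^sub>C x) \<le> norm c * K"
    by (rule exI[of _ "norm x"]) (simp add: norm_scaleC)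
qed (rule scaleC_add_left)

subsection \<open>Relatively compact sets\<close>

lemma compact_closure_if_subset_compact:
  fixes A :: "'a :: metric_space set"
  assumes "compact K" "A \<subseteq> K"
  shows "compact (closure A)"
proof -
  have "closure A \<subseteq> K"
    using assms by (intro closure_minimal compact_imp_closed)
  then have "K \<inter> closure A = closure A"
    by blast
  then show ?thesis
    using compact_Int_closed[OF assms(1) closed_closure, of A] by simp
qed

text \<open>In a complete space total boundedness suffices. A finite net of \<open>K\<close> at
  scale \<open>e / 4\<close> gives closed balls of radius \<open>e / 2\<close> covering
  \<open>A\<close>. Being closed, their finite union also contains the closure of \<open>A\<close>;
  open balls of radius \<open>e\<close> then cover it.\<close>

lemma compact_closure_if_approx:
  fixes A :: "'a :: complete_space set"
  assumes approx: "\<And>e. e > 0 \<Longrightarrow> \<exists>K. compact K \<and> (\<forall>x\<in>A. \<exists>y\<in>K. dist x y \<le> e)"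
  shows "compact (closure A)"
  unfolding compact_eq_totally_bounded
proof (intro conjI allI impI)
  show "complete (closure A)"
    by (simp add: complete_eq_closed)
  fix e :: real
  assume e: "e > 0"
  then obtain K where K: "compact K" "\<And>x. x \<in> A \<Longrightarrow> \<exists>y\<in>K. dist x y \<le> e / 4"
    using approx[of "e / 4"] by auto
  from K(1) e obtain F where F: "finite F" "K \<subseteq> (\<Union>z\<in>F. ball z (e / 4))"
    unfolding compact_eq_totally_bounded by (meson divide_pos_pos zero_less_numeral)
  have "A \<subseteq> (\<Union>z\<in>F. cball z (e / 2))"
  proof
    fix x assume "x \<in> A"
    then obtain y where y: "y \<in> K" "dist x y \<le> e / 4"
      using K by blast
    then obtain z where z: "z \<in> F" "dist z y < e / 4"
      using F by auto
    have "dist z x \<le> dist z y + dist x y"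
      by (metis dist_commute dist_triangle)
    then show "x \<in> (\<Union>z\<in>F. cball z (e / 2))"
      using y z by force
  qed
  then have "closure A \<subseteq> (\<Union>z\<in>F. cball z (e / 2))"
    using F(1) by (intro closure_minimal closed_UN) auto
  also have "\<dots> \<subseteq> (\<Union>z\<in>F. ball z e)"
    using e by (intro UN_mono) auto
  finally show "\<exists>F. finite F \<and> closure A \<subseteq> (\<Union>z\<in>F. ball z e)"
    using F(1) by blast
qed

text \<open>Each new term ranges over the continuous image of a closed disc, and the sum of two
  compact sets is compact. One \<open>K\<close> has to serve all admissible coefficient
  sequences.\<close>

lemma compact_bounded_combinations:
  fixes v :: "nat \<Rightarrow> 'a :: complex_normed_vector"
  shows "\<exists>K. compact K \<and> (\<forall>a. (\<forall>i. cmod (a i) \<le> b i) \<longrightarrow> (\<Sum>i<n. a i *\<^sub>C v i) \<in> K)"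
proof (induction n)
  case 0
  show ?case by (rule exI[of _ "{0}"]) simp
next
  case (Suc n)
  then obtain K where K: "compact K"
    "\<And>a. (\<forall>i. cmod (a i) \<le> b i) \<Longrightarrow> (\<Sum>i<n. a i *\<^sub>C v i) \<in> K"
    by blast
  let ?L = "(\<lambda>c. c *\<^sub>C v n) ` cball 0 (b n)"
  have "compact ?L"
    by (intro compact_continuous_image linear_continuous_on bounded_linear_scaleC_left compact_cball)
  then have "compact {x + y | x y. x \<in> K \<and> y \<in> ?L}"
    by (rule compact_sums[OF K(1)])
  moreover have "(\<Sum>i<Suc n. a i *\<^sub>C v i) \<in> {x + y | x y. x \<in> K \<and> y \<in> ?L}"
    if "\<forall>i. cmod (a i) \<le> b i" for a
  proof -
    have "a n *\<^sub>C v n \<in> ?L"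
      using that by (intro imageI) simp
    then show ?thesis
      using K(2)[OF that] unfolding sum.lessThan_Suc by blast
  qed
  ultimately show ?case by blast
qed

lemma sum_power_tail_le:
  fixes q :: real
  assumes "0 \<le> q" "q < 1"
  shows "(\<Sum>i=n..m. q ^ i) \<le> q ^ n / (1 - q)"
proof (cases "n \<le> m")
  case True
  have "(1 - q) * (\<Sum>i=n..m. q ^ i) \<le> q ^ n"
    using sum_gp_multiplied[OF True, of q] assms by simp
  then show ?thesis
    using assms by (simp add: pos_le_divide_eq mult.commute)
qed (use assms in simp)

text \<open>The terms below a fixed index \<open>N\<close> contribute an element of a compact set,
  and the others are dominated by the geometric series of ratio \<open>s / r\<close>. The tail bound
  depends neither on the coefficients nor on \<open>m\<close>.\<close>

lemma compact_closure_power_combinations: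
  fixes v :: "nat \<Rightarrow> 'a :: complex_banach"
  assumes s: "0 < s" "s < r" and v: "\<forall>\<^sub>F n in sequentially. norm (v n) \<le> s ^ n"
  shows "compact (closure {\<Sum>i\<le>m. a i *\<^sub>C v i | a m. \<forall>i. cmod (a i) \<le> 1 / r ^ i})"
proof (rule compact_closure_if_approx)
  fix e :: real
  assume e: "e > 0"
  define q where "q = s / r"
  have q: "0 \<le> q" "q < 1"
    using s by (auto simp: q_def)
  have "(\<lambda>n. q ^ n / (1 - q)) \<longlonglongrightarrow> 0 / (1 - q)"
    using q by (intro tendsto_intros LIMSEQ_power_zero) auto
  then have "\<forall>\<^sub>F n in sequentially. q ^ n / (1 - q) < e"
    using e by (intro order_tendstoD) auto
  from eventually_conj[OF this v]
  obtain N where N: "q ^ N / (1 - q) < e" "\<And>n. n \<ge> N \<Longrightarrow> norm (v n) \<le> s ^ n"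
    unfolding eventually_sequentially by blast
  obtain K where K: "compact K"
    "\<And>a. (\<forall>i. cmod (a i) \<le> 1 / r ^ i) \<Longrightarrow> (\<Sum>i<N. a i *\<^sub>C v i) \<in> K"
    using compact_bounded_combinations[of "\<lambda>i. 1 / r ^ i" v N] by auto
  have "\<exists>y\<in>K. dist (\<Sum>i\<le>m. a i *\<^sub>C v i) y \<le> e"
    if a: "\<forall>i. cmod (a i) \<le> 1 / r ^ i" for a m
  proof
    \<comment> \<open>Coefficients beyond \<open>m\<close> are replaced by 0, so that short sums
      also become combinations of exactly \<open>N\<close> vectors and the same \<open>K\<close>
      serves every \<open>m\<close>.\<close>
    let ?y = "\<Sum>i<N. (if i \<le> m then a i else 0) *\<^sub>C v i"
    show "?y \<in> K"
      using a s by (intro K) auto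
    have y: "?y = (\<Sum>i | i < N \<and> i \<le> m. a i *\<^sub>C v i)"
      by (rule sum.mono_neutral_cong_right) auto
    have eq: "{..m} = {i. i < N \<and> i \<le> m} \<union> {N..m}"
      by auto
    have "(\<Sum>i\<le>m. a i *\<^sub>C v i) = ?y + (\<Sum>i=N..m. a i *\<^sub>C v i)"
      unfolding y eq by (rule sum.union_disjoint) auto
    then have "dist (\<Sum>i\<le>m. a i *\<^sub>C v i) ?y = norm (\<Sum>i=N..m. a i *\<^sub>C v i)"
      unfolding dist_norm by (metis add_diff_cancel_left')
    also have "\<dots> \<le> (\<Sum>i=N..m. q ^ i)"
    proof (rule sum_norm_le)
      fix i assume "i \<in> {N..m}"
      then have "cmod (a i) * norm (v i) \<le> (1 / r ^ i) * s ^ i"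
        using a N(2) s by (intro mult_mono) auto
      then show "norm (a i *\<^sub>C v i) \<le> q ^ i"
        by (simp add: norm_scaleC q_def power_divide)
    qed
    also have "\<dots> \<le> e"
      using sum_power_tail_le[OF q, of N m] N(1) by linarith
    finally show "dist (\<Sum>i\<le>m. a i *\<^sub>C v i) ?y \<le> e" .
  qed
  then show "\<exists>K. compact K \<and> (\<forall>x\<in>{\<Sum>i\<le>m. a i *\<^sub>C v i | a m. \<forall>i. cmod (a i) \<le> 1 / r ^ i}.
      \<exists>y\<in>K. dist x y \<le> e)"
    using K(1) by (intro exI[of _ K] conjI ballI) auto
qed

subsection \<open>Compactness in the strong operator topology\<close>

text \<open>On the span, linearity puts the orbit of \<open>c *\<^sub>C y + z\<close> inside a sum
  of two compact sets. For a limit of such vectors, the common norm bound 1 makes the orbits of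
  nearby vectors uniformly close, so compact sets approximate the orbit.\<close>

lemma compact_closure_orbits:
  fixes B :: "('a :: complex_normed_vector \<Rightarrow>\<^sub>L 'b :: complex_banach) set"
  assumes lin: "\<And>A c x. A \<in> B \<Longrightarrow> A (c *\<^sub>C x) = c *\<^sub>C A x"
    and bound: "\<And>A. A \<in> B \<Longrightarrow> norm A \<le> 1"
    and S: "spanning_set S" "\<And>x. x \<in> S \<Longrightarrow> compact (closure ((\<lambda>A. blinfun_apply A x) ` B))"
  shows "compact (closure ((\<lambda>A. blinfun_apply A x) ` B))"
proof -
  let ?O = "\<lambda>x. (\<lambda>A. blinfun_apply A x) ` B"
  have span: "compact (closure (?O y))" if "y \<in> cspan S" for y
    using that unfolding cspan_def
  proof (induction rule: scaleC.span_induct_alt)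
    case base
    show ?case
      by (rule compact_closure_if_subset_compact[of "{0}"]) auto
  next
    case (step c y z)
    have "compact ((\<lambda>w. c *\<^sub>C w) ` closure (?O y))"
      using S(2)[OF step(1)]
      by (intro compact_continuous_image linear_continuous_on bounded_linear_scaleC)
    from compact_sums[OF this step(2)] show ?case
    proof (rule compact_closure_if_subset_compact)
      show "?O (c *\<^sub>C y + z) \<subseteq>
          {u + v | u v. u \<in> (\<lambda>w. c *\<^sub>C w) ` closure (?O y) \<and> v \<in> closure (?O z)}"
      proof
        fix u assume "u \<in> ?O (c *\<^sub>C y + z)"
        then obtain A where A: "A \<in> B" "u = c *\<^sub>C A y + A z"
          by (auto simp: blinfun.add_right lin)
        then have "A y \<in> closure (?O y)" "A z \<in> closure (?O z)"
          using closure_subset[of "?O y"] closure_subset[of "?O z"] by auto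
        then show "u \<in> {u + v | u v. u \<in> (\<lambda>w. c *\<^sub>C w) ` closure (?O y) \<and> v \<in> closure (?O z)}"
          using A(2) by blast
      qed
    qed
  qed
  show ?thesis
  proof (rule compact_closure_if_approx)
    fix e :: real
    assume "e > 0"
    moreover have "x \<in> closure (cspan S)"
      using S(1) by (simp add: spanning_set_def)
    ultimately obtain y where y: "y \<in> cspan S" "dist y x < e"
      unfolding closure_approachable by auto
    have "\<exists>z\<in>closure (?O y). dist u z \<le> e" if u: "u \<in> ?O x" for u
    proof -
      from u obtain A where A: "A \<in> B" "u = A x"
        by auto
      have "dist u (A y) \<le> norm A * norm (x - y)"
        using norm_blinfun[of A "x - y"] by (simp add: A dist_norm blinfun.diff_right)
      also have "\<dots> \<le> 1 * norm (x - y)"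
        using bound[OF A(1)] by (rule mult_right_mono) simp
      also have "\<dots> \<le> e"
        using y by (simp add: dist_norm norm_minus_commute)
      finally show ?thesis
        using A(1) closure_subset[of "?O y"] by (intro bexI[of _ "A y"]) auto
    qed
    then show "\<exists>K. compact K \<and> (\<forall>u\<in>?O x. \<exists>z\<in>K. dist u z \<le> e)"
      using span[OF y(1)] by (intro exI[of _ "closure (?O y)"] conjI ballI)
  qed
qed

text \<open>By Tychonoff's theorem the product of the orbit closures is compact. The linear
  contractions in it form a closed part \<open>F\<close>, whose image under \<open>Blinfun\<close>
  is compact and closed in \<open>SOT\<close> and contains \<open>B\<close>.\<close>

lemma compactin_SOT_closure:
  fixes B :: "('a :: complex_normed_vector \<Rightarrow>\<^sub>L 'a) set"
  assumes B: "B \<subseteq> bounded_ops"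
    and bound: "\<And>A. A \<in> B \<Longrightarrow> norm A \<le> 1"
    and orbits: "\<And>x. compact (closure ((\<lambda>A. blinfun_apply A x) ` B))"
  shows "compactin SOT (SOT closure_of B)"
proof -
  define K where "K x = closure ((\<lambda>A. blinfun_apply A x) ` B)" for x
  \<comment> \<open>The norm inequality is a pointwise closed condition, like linearity, and it
    makes every member of \<open>F\<close> a bounded operator.\<close>
  define F :: "('a \<Rightarrow> 'a) set" where
    "F = PiE UNIV K \<inter> {f. (\<forall>x y. f (x + y) = f x + f y) \<and> (\<forall>c x. f (c *\<^sub>C x) = c *\<^sub>C f x) \<and>
                           (\<forall>x. norm (f x) \<le> norm x)}"
  have compact_K: "compact (PiE UNIV K)"
    using orbits compactin_PiE[of "\<lambda>_ :: 'a. euclidean :: 'a topology" UNIV K]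
    by (simp add: euclidean_product_topology K_def)
  have "continuous_on UNIV (\<lambda>f :: 'a \<Rightarrow> 'a. c *\<^sub>C f x)" for c x
    by (rule continuous_on_compose2[of UNIV _ UNIV "\<lambda>f. f x"])
      (simp_all add: linear_continuous_on[OF bounded_linear_scaleC])
  then have "closed {f :: 'a \<Rightarrow> 'a. f (c *\<^sub>C x) = c *\<^sub>C f x}" for c x
    by (rule closed_Collect_eq[OF continuous_on_product_coordinates])
  moreover have "closed {f :: 'a \<Rightarrow> 'a. f (x + y) = f x + f y}" for x y
    by (intro closed_Collect_eq continuous_on_add continuous_on_product_coordinates)
  moreover have "closed {f :: 'a \<Rightarrow> 'a. norm (f x) \<le> norm x}" for x
    by (intro closed_Collect_le continuous_on_norm continuous_on_const
        continuous_on_product_coordinates)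
  ultimately have closed: "closed {f :: 'a \<Rightarrow> 'a. (\<forall>x y. f (x + y) = f x + f y) \<and>
      (\<forall>c x. f (c *\<^sub>C x) = c *\<^sub>C f x) \<and> (\<forall>x. norm (f x) \<le> norm x)}"
    by (intro closed_Collect_conj closed_Collect_all)
  have "compact F"
    unfolding F_def using compact_K closed by (rule compact_Int_closed)
  have linear: "bounded_linear f" if "f \<in> F" for f
  proof
    show "f (x + y) = f x + f y" for x y
      using that by (simp add: F_def)
    show "f (r *\<^sub>R x) = r *\<^sub>R f x" for r x
      using that by (simp add: F_def scaleR_scaleC)
    show "\<exists>M. \<forall>x. norm (f x) \<le> norm x * M"
      using that by (auto simp: F_def intro!: exI[of _ 1])
  qed
  \<comment> \<open>\<open>Blinfun f\<close> acts as \<open>f\<close> when \<open>f\<close> is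
    bounded linear, hence the restriction to \<open>F\<close>. Continuity then reduces to that of
    the coordinate projections.\<close>
  have "continuous_map (top_of_set F) strong_operator_topology Blinfun"
    unfolding continuous_on_strong_operator_topo_iff_coordinatewise
  proof
    fix x
    have "continuous_on F (\<lambda>f. f x)"
      by (rule continuous_on_subset[OF continuous_on_product_coordinates]) simp
    then have "continuous_on F (\<lambda>f. blinfun_apply (Blinfun f) x)"
      by (rule continuous_on_eq) (simp add: bounded_linear_Blinfun_apply linear)
    then show "continuous_map (top_of_set F) euclidean (\<lambda>f. blinfun_apply (Blinfun f) x)"
      by simp
  qed
  moreover have img: "Blinfun ` F \<subseteq> bounded_ops"
    by (auto simp: bounded_ops_def bounded_linear_Blinfun_apply linear) (simp add: F_def)
  ultimately have "continuous_map (top_of_set F) SOT Blinfun"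
    by (auto simp: SOT_def continuous_map_in_subtopology)
  moreover have "compactin (top_of_set F) F"
    using \<open>compact F\<close> by (simp add: compactin_subtopology)
  ultimately have compact: "compactin SOT (Blinfun ` F)"
    by (rule image_compactin[rotated])
  \<comment> \<open>The image is rewritten as a preimage under \<open>blinfun_apply\<close>, so that
    its closedness in \<open>SOT\<close> follows from that of \<open>F\<close> in the product
    topology.\<close>
  have eq: "Blinfun ` F = {A \<in> topspace SOT. blinfun_apply A \<in> F}"
  proof safe
    fix f assume "f \<in> F"
    then show "Blinfun f \<in> topspace SOT" "blinfun_apply (Blinfun f) \<in> F"
      using img by (auto simp: SOT_def strong_operator_topology_topspace
          bounded_linear_Blinfun_apply linear)
  next
    fix A :: "'a \<Rightarrow>\<^sub>L 'a"
    assume "blinfun_apply A \<in> F"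
    then show "A \<in> Blinfun ` F"
      by (intro image_eqI[of _ _ "blinfun_apply A"]) (simp add: blinfun_apply_inverse)
  qed
  have "continuous_map strong_operator_topology euclidean (blinfun_apply :: ('a \<Rightarrow>\<^sub>L 'a) \<Rightarrow> _)"
    unfolding strong_operator_topology_def
    using continuous_map_pullback[OF continuous_map_id, of UNIV blinfun_apply] by simp
  then have "continuous_map SOT euclidean (blinfun_apply :: ('a \<Rightarrow>\<^sub>L 'a) \<Rightarrow> _)"
    unfolding SOT_def by (rule continuous_map_from_subtopology)
  moreover have "closedin (product_topology (\<lambda>_. euclidean) UNIV) (PiE UNIV K)"
    by (simp add: closedin_product_topology K_def)
  then have "closed F"
    unfolding F_def using closed by (simp add: euclidean_product_topology closed_Int)
  ultimately have "closedin SOT (Blinfun ` F)"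
    unfolding eq by (intro closedin_continuous_map_preimage[of _ euclidean]) auto
  moreover have "B \<subseteq> Blinfun ` F"
  proof
    fix A assume A: "A \<in> B"
    have "norm (A x) \<le> norm x" for x
      using norm_blinfun[of A x] bound[OF A] mult_right_mono[of "norm A" 1 "norm x"] by simp
    moreover have "A x \<in> K x" for x
      using A closure_subset by (fastforce simp: K_def)
    ultimately have "blinfun_apply A \<in> F"
      using A B by (auto simp: F_def blinfun.add_right bounded_ops_def)
    then show "A \<in> Blinfun ` F"
      by (intro image_eqI[of _ _ "blinfun_apply A"]) (simp add: blinfun_apply_inverse)
  qed
  ultimately have "SOT closure_of B \<subseteq> Blinfun ` F"
    by (rule closure_of_minimal[rotated])
  then show ?thesis
    by (rule closed_compactin[OF compact _ closedin_closure_of])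
qed

subsection \<open>Inverses and the spectrum\<close>

definition op_invertible :: "('a :: complex_normed_vector \<Rightarrow>\<^sub>L 'a) \<Rightarrow> bool"
  where "op_invertible A \<longleftrightarrow> (\<exists>R\<in>bounded_ops. R o\<^sub>L A = id_blinfun \<and> A o\<^sub>L R = id_blinfun)"

lemma op_spectrum_iff: "z \<in> op_spectrum T \<longleftrightarrow> \<not> op_invertible (T - z *\<^sub>C id_blinfun)"
  by (simp add: op_spectrum_def op_invertible_def)

lemma bounded_opsD: "A \<in> bounded_ops \<Longrightarrow> A (c *\<^sub>C x) = c *\<^sub>C A x"
  by (simp add: bounded_ops_def)

lemma id_blinfun_bounded_ops: "id_blinfun \<in> bounded_ops"
  by (simp add: bounded_ops_def)

lemma compose_bounded_ops: "A \<in> bounded_ops \<Longrightarrow> B \<in> bounded_ops \<Longrightarrow> A o\<^sub>L B \<in> bounded_ops"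
  by (simp add: bounded_ops_def)

lemma scaleC_bounded_ops: "A \<in> bounded_ops \<Longrightarrow> c *\<^sub>C A \<in> bounded_ops"
  by (simp add: bounded_ops_def scaleC_blinfun.rep_eq scaleC_scaleC mult.commute)

lemma add_bounded_ops: "A \<in> bounded_ops \<Longrightarrow> B \<in> bounded_ops \<Longrightarrow> A + B \<in> bounded_ops"
  by (simp add: bounded_ops_def blinfun.add_left scaleC_add_right)

lemma blinfun_compose_assoc: "(A o\<^sub>L B) o\<^sub>L C = A o\<^sub>L (B o\<^sub>L C)"
  by (rule blinfun_eqI) simp

lemma blinfun_compose_id [simp]: "A o\<^sub>L id_blinfun = A" "id_blinfun o\<^sub>L A = A"
  by (rule blinfun_eqI, simp)+

text \<open>Associativity forces the left and right inverses to agree, so complex linearity has to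
  be checked for the left one only.\<close>

lemma op_invertibleI:
  assumes "L \<in> bounded_ops" "L o\<^sub>L A = id_blinfun" "A o\<^sub>L R = id_blinfun"
  shows "op_invertible A"
proof -
  have "L = R"
    using assms(2,3) blinfun_compose_assoc[of L A R] by simp
  then show ?thesis
    using assms by (auto simp: op_invertible_def)
qed

lemma norm_id_blinfun_le: "norm (id_blinfun :: 'a :: real_normed_vector \<Rightarrow>\<^sub>L 'a) \<le> 1"
  by (rule norm_blinfun_bound) auto

lemma op_power_Suc: "op_power T (Suc n) = T o\<^sub>L op_power T n"
  by (simp add: op_power_def)

lemma op_power_Suc_right: "op_power T (Suc n) = op_power T n o\<^sub>L T"
  by (rule blinfun_eqI) (simp add: blinfun_apply_op_power funpow_swap1)

lemma op_power_bounded_ops: "T \<in> bounded_ops \<Longrightarrow> op_power T n \<in> bounded_ops"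
  by (induction n) (simp_all add: op_power_Suc compose_bounded_ops,
      simp add: op_power_def id_blinfun_bounded_ops)

lemma norm_op_power_le: "norm (op_power T n) \<le> norm T ^ n"
proof (induction n)
  case 0
  show ?case by (simp add: op_power_def norm_id_blinfun_le)
next
  case (Suc n)
  have "norm (op_power T (Suc n)) \<le> norm T * norm (op_power T n)"
    unfolding op_power_Suc by (rule norm_blinfun_compose)
  also have "\<dots> \<le> norm T ^ Suc n"
    using Suc by (simp add: mult_left_mono)
  finally show ?case .
qed

text \<open>The inverse is the Neumann series \<open>R\<close> of the powers of \<open>B\<close>:
  splitting off its first term gives \<open>R = (B o\<^sub>L R) + id_blinfun\<close>, and likewise
  with the factors swapped.\<close>

lemma op_invertible_Neumann:
  fixes B :: "'a :: complex_banach \<Rightarrow>\<^sub>L 'a"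
  assumes B: "B \<in> bounded_ops" "norm B < 1"
  shows "op_invertible (id_blinfun - B)"
proof -
  have "summable (\<lambda>n. norm (op_power B n))"
    by (rule summable_comparison_test'[of "\<lambda>n. norm B ^ n" 0])
      (use B(2) norm_op_power_le in \<open>auto intro: summable_geometric\<close>)
  then have sum: "summable (op_power B)"
    by (rule summable_norm_cancel)
  define R where "R = suminf (op_power B)"
  have R: "R = suminf (\<lambda>n. op_power B (Suc n)) + id_blinfun"
    using suminf_split_head[OF sum] by (simp add: R_def op_power_def)
  have "B o\<^sub>L R = suminf (\<lambda>n. B o\<^sub>L op_power B n)"
    unfolding R_def by (rule bounded_linear.suminf[OF
          bounded_bilinear.bounded_linear_right[OF bounded_bilinear_blinfun_compose] sum])
  moreover have "R o\<^sub>L B = suminf (\<lambda>n. op_power B n o\<^sub>L B)"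
    unfolding R_def by (rule bounded_linear.suminf[OF
          bounded_bilinear.bounded_linear_left[OF bounded_bilinear_blinfun_compose] sum])
  ultimately have "R = (B o\<^sub>L R) + id_blinfun" "R = (R o\<^sub>L B) + id_blinfun"
    using R by (simp_all only: op_power_Suc[symmetric] op_power_Suc_right[symmetric])
  then have inv: "R o\<^sub>L (id_blinfun - B) = id_blinfun" "(id_blinfun - B) o\<^sub>L R = id_blinfun"
    unfolding bounded_bilinear.diff_left[OF bounded_bilinear_blinfun_compose]
      bounded_bilinear.diff_right[OF bounded_bilinear_blinfun_compose]
    by (simp_all add: diff_eq_eq add.commute)
  \<comment> \<open>The series converges in the space of real-linear operators; complex linearity of
    its sum is checked at each vector, where scalars pass through the sum.\<close>
  have R_apply: "R x = suminf (\<lambda>n. op_power B n x)" for x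
    unfolding R_def by (rule bounded_linear.suminf[OF blinfun.bounded_linear_left sum])
  have summable: "summable (\<lambda>n. op_power B n x)" for x
    using bounded_linear.summable[OF blinfun.bounded_linear_left sum] .
  have "R (c *\<^sub>C x) = c *\<^sub>C R x" for c x
    unfolding R_apply bounded_linear.suminf[OF bounded_linear_scaleC summable]
    by (simp add: bounded_opsD op_power_bounded_ops B)
  then have "R \<in> bounded_ops"
    by (simp add: bounded_ops_def)
  then show ?thesis
    using inv by (auto simp: op_invertible_def)
qed

text \<open>The resolvent set is open: if \<open>R\<close> inverts \<open>T - z\<close> and
  \<open>h = w - z\<close>, then multiplying \<open>T - w\<close> by \<open>R\<close> on either side
  gives \<open>I - h R\<close>, which the Neumann series inverts for small \<open>h\<close>.\<close>

lemma closed_op_spectrum: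
  fixes T :: "'a :: complex_banach \<Rightarrow>\<^sub>L 'a"
  shows "closed (op_spectrum T)"
proof -
  have "\<exists>e>0. ball z e \<subseteq> - op_spectrum T" if z: "z \<in> - op_spectrum T" for z
  proof -
    define A where "A = T - z *\<^sub>C id_blinfun"
    obtain R where R: "R \<in> bounded_ops" "R o\<^sub>L A = id_blinfun" "A o\<^sub>L R = id_blinfun"
      using z by (auto simp: op_spectrum_iff op_invertible_def A_def)
    \<comment> \<open>The radius makes the norm of \<open>h *\<^sub>C R\<close> less than 1; the
      summand 1 keeps the denominator positive even if \<open>R = 0\<close>.\<close>
    have "w \<notin> op_spectrum T" if w: "w \<in> ball z (1 / (norm R + 1))" for w
    proof -
      define h where "h = w - z"
      have "cmod h * norm R \<le> cmod h * (norm R + 1)"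
        by (simp add: algebra_simps)
      also have "\<dots> < 1"
        using w by (simp add: h_def dist_norm norm_minus_commute pos_less_divide_eq add_nonneg_pos)
      finally have "op_invertible (id_blinfun - h *\<^sub>C R)"
        by (intro op_invertible_Neumann scaleC_bounded_ops R) (simp add: norm_scaleC)
      then obtain S where S: "S \<in> bounded_ops" "S o\<^sub>L (id_blinfun - h *\<^sub>C R) = id_blinfun"
        "(id_blinfun - h *\<^sub>C R) o\<^sub>L S = id_blinfun"
        by (auto simp: op_invertible_def)
      have R_apply: "R (A x) = x" "A (R x) = x" for x
        using R(2,3) by (metis blinfun_apply_blinfun_compose blinfun_apply_id_blinfun)+
      have S_apply: "S (x - h *\<^sub>C R x) = x" "S x - h *\<^sub>C R (S x) = x" for x
        using arg_cong[OF S(2), of "\<lambda>f. blinfun_apply f x"]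
          arg_cong[OF S(3), of "\<lambda>f. blinfun_apply f x"]
        by (simp_all add: blinfun.diff_left scaleC_blinfun.rep_eq)
      have T_apply: "(T - w *\<^sub>C id_blinfun) x = A x - h *\<^sub>C x" for x
        by (simp add: A_def h_def blinfun.diff_left scaleC_blinfun.rep_eq scaleC.scale_left_diff_distrib)
      have "op_invertible (T - w *\<^sub>C id_blinfun)"
      proof (rule op_invertibleI)
        show "S o\<^sub>L R \<in> bounded_ops"
          using S R by (simp add: compose_bounded_ops)
        show "(S o\<^sub>L R) o\<^sub>L (T - w *\<^sub>C id_blinfun) = id_blinfun"
          by (rule blinfun_eqI)
            (simp add: T_apply blinfun.diff_right[of R] bounded_opsD[OF R(1)] R_apply S_apply)
        show "(T - w *\<^sub>C id_blinfun) o\<^sub>L (R o\<^sub>L S) = id_blinfun"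
          by (rule blinfun_eqI) (simp add: T_apply R_apply S_apply)
      qed
      then show ?thesis
        by (simp add: op_spectrum_iff)
    qed
    then show ?thesis
      by (intro exI[of _ "1 / (norm R + 1)"]) (auto simp: add_nonneg_pos)
  qed
  then show ?thesis
    by (simp add: closed_def open_contains_ball)
qed

subsection \<open>Polynomials in an operator\<close>

lemma op_poly_0: "op_poly 0 T = 0"
  by (simp add: op_poly_def)

text \<open>This Horner recursion allows induction along \<open>pCons\<close> in place of
  manipulating indexed sums.\<close>

lemma op_poly_pCons:
  fixes T :: "'a :: complex_normed_vector \<Rightarrow>\<^sub>L 'a"
  assumes "T \<in> bounded_ops"
  shows "op_poly (pCons a p) T = a *\<^sub>C id_blinfun + (T o\<^sub>L op_poly p T)"
proof (rule blinfun_eqI)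
  fix x
  show "op_poly (pCons a p) T x = (a *\<^sub>C id_blinfun + (T o\<^sub>L op_poly p T)) x"
  \<comment> \<open>The degree of \<open>pCons a p\<close> is \<open>Suc (degree p)\<close> only
    when \<open>p\<close> is nonzero.\<close>
  proof (cases "p = 0")
    case True
    then show ?thesis
      by (simp add: blinfun_apply_op_poly blinfun.add_left scaleC_blinfun.rep_eq)
  next
    case False
    then show ?thesis
      by (simp add: blinfun_apply_op_poly sum.atMost_Suc_shift blinfun.add_left blinfun.sum_right
          scaleC_blinfun.rep_eq bounded_opsD[OF assms] del: sum.atMost_Suc)
  qed
qed

lemma op_poly_bounded_ops: "T \<in> bounded_ops \<Longrightarrow> op_poly p T \<in> bounded_ops"
  by (induction p) (simp_all add: op_poly_pCons op_poly_0 add_bounded_ops compose_bounded_ops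
      scaleC_bounded_ops id_blinfun_bounded_ops, simp add: bounded_ops_def)

lemma op_poly_commute: "T \<in> bounded_ops \<Longrightarrow> op_poly p T (T x) = T (op_poly p T x)"
  by (induction p) (simp_all add: op_poly_pCons op_poly_0 blinfun.add_left blinfun.add_right
      scaleC_blinfun.rep_eq bounded_opsD)

text \<open>In a Horner step the quotient gains the constant coefficient \<open>poly p z\<close>, so
  applying \<open>T\<close> to the previous identity yields the next one. The resulting factor
  \<open>T - z\<close> links invertibility of \<open>p(T) - p(z)\<close> to the spectrum.\<close>

lemma op_poly_synthetic_div:
  assumes T: "T \<in> bounded_ops"
  shows "op_poly p T x - poly p z *\<^sub>C x =
    T (op_poly (synthetic_div p z) T x) - z *\<^sub>C op_poly (synthetic_div p z) T x"
proof (induction p)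
  case 0
  show ?case by (simp add: op_poly_0)
next
  case (pCons a p)
  let ?q = "op_poly (synthetic_div p z) T"
  have "op_poly p T x = T (?q x) - z *\<^sub>C ?q x + poly p z *\<^sub>C x"
    using pCons.IH by (simp add: algebra_simps)
  then show ?case
    by (simp add: op_poly_pCons[OF T] blinfun.bilinear_simps scaleC_blinfun.rep_eq
        bounded_opsD[OF T] scaleC.scale_left_distrib scaleC.scale_right_distrib
        scaleC.scale_right_diff_distrib mult.commute)
qed

lemma norm_poly_spectrum_le:
  fixes T :: "'a :: complex_banach \<Rightarrow>\<^sub>L 'a"
  assumes T: "T \<in> bounded_ops" and z: "z \<in> op_spectrum T"
  shows "cmod (poly p z) \<le> norm (op_poly p T)"
  \<comment> \<open>Otherwise \<open>p(T) - p(z)\<close> is invertible, and so is its factor \<open>T - z\<close>.\<close>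
proof (rule ccontr)
  assume less: "\<not> ?thesis"
  define c where "c = poly p z"
  let ?q = "op_poly (synthetic_div p z) T"
  have c: "c \<noteq> 0"
    using less by (auto simp: c_def)
  have "norm (op_poly p T) / cmod c < 1"
    using less c by (simp add: c_def)
  then have "norm (inverse c *\<^sub>C op_poly p T) < 1"
    by (simp add: norm_scaleC norm_inverse divide_inverse mult.commute)
  then have "op_invertible (id_blinfun - inverse c *\<^sub>C op_poly p T)"
    using T by (intro op_invertible_Neumann scaleC_bounded_ops op_poly_bounded_ops)
  then obtain R where R: "R \<in> bounded_ops"
    "R o\<^sub>L (id_blinfun - inverse c *\<^sub>C op_poly p T) = id_blinfun"
    "(id_blinfun - inverse c *\<^sub>C op_poly p T) o\<^sub>L R = id_blinfun"
    by (auto simp: op_invertible_def)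
  have R_apply: "R (x - inverse c *\<^sub>C op_poly p T x) = x"
    "R x - inverse c *\<^sub>C op_poly p T (R x) = x" for x
    using arg_cong[OF R(2), of "\<lambda>f. blinfun_apply f x"]
      arg_cong[OF R(3), of "\<lambda>f. blinfun_apply f x"]
    by (simp_all add: blinfun.diff_left scaleC_blinfun.rep_eq)
  have q: "T (?q x) - z *\<^sub>C ?q x = (- c) *\<^sub>C (x - inverse c *\<^sub>C op_poly p T x)" for x
    using op_poly_synthetic_div[OF T, of p x z] c
    by (simp add: c_def scaleC.scale_right_diff_distrib)
  have q': "?q (T x - z *\<^sub>C x) = T (?q x) - z *\<^sub>C ?q x" for x
    by (simp add: blinfun.diff_right op_poly_commute[OF T] bounded_opsD[OF op_poly_bounded_ops[OF T]])
  have "op_invertible (T - z *\<^sub>C id_blinfun)"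
  proof (rule op_invertibleI)
    \<comment> \<open>As \<open>?q\<close> commutes with \<open>T\<close>, both products of
      \<open>?q\<close> and \<open>T - z\<close> equal \<open>-c\<close> times the operator inverted
      by \<open>R\<close>. Placing \<open>R\<close> on the outer side in each one-sided inverse
      avoids showing that it commutes with \<open>?q\<close>.\<close>
    show "(- inverse c) *\<^sub>C (R o\<^sub>L ?q) \<in> bounded_ops"
      using R T by (intro scaleC_bounded_ops compose_bounded_ops op_poly_bounded_ops)
    show "((- inverse c) *\<^sub>C (R o\<^sub>L ?q)) o\<^sub>L (T - z *\<^sub>C id_blinfun) = id_blinfun"
      by (rule blinfun_eqI)
        (use c in \<open>simp add: blinfun.diff_left scaleC_blinfun.rep_eq q' q bounded_opsD[OF R(1)] R_apply
            blinfun.minus_left blinfun.minus_right\<close>)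
    show "(T - z *\<^sub>C id_blinfun) o\<^sub>L (?q o\<^sub>L ((- inverse c) *\<^sub>C R)) = id_blinfun"
    proof (rule blinfun_eqI)
      fix x
      define y where "y = (- inverse c) *\<^sub>C R x"
      have "(T - z *\<^sub>C id_blinfun) (?q y) = (- c) *\<^sub>C (y - inverse c *\<^sub>C op_poly p T y)"
        using q[of y] by (simp add: blinfun.diff_left scaleC_blinfun.rep_eq)
      also have "y - inverse c *\<^sub>C op_poly p T y = (- inverse c) *\<^sub>C (R x - inverse c *\<^sub>C op_poly p T (R x))"
        unfolding y_def bounded_opsD[OF op_poly_bounded_ops[OF T]]
        by (simp add: scaleC.scale_right_diff_distrib)
      also have "(- c) *\<^sub>C \<dots> = x"
        using c R_apply(2)[of x] by simp
      finally show "((T - z *\<^sub>C id_blinfun) o\<^sub>L (?q o\<^sub>L ((- inverse c) *\<^sub>C R))) x = id_blinfun x"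
        by (simp add: y_def scaleC_blinfun.rep_eq blinfun.minus_left)
    qed
  qed
  then show False
    using z by (simp add: op_spectrum_iff)
qed

text \<open>A point of the hull off the spectrum lies in a bounded component of the complement. The
  frontier of that component lies in the closed spectrum, where the bound is known, and the maximum
  modulus principle carries it inside.\<close>

lemma norm_poly_full_hull_le:
  fixes T :: "'a :: complex_banach \<Rightarrow>\<^sub>L 'a"
  assumes T: "T \<in> bounded_ops" and z: "z \<in> full_hull (op_spectrum T)"
  shows "cmod (poly p z) \<le> norm (op_poly p T)"
proof (cases "z \<in> op_spectrum T")
  case True
  with T show ?thesis by (rule norm_poly_spectrum_le)
next
  case False
  let ?C = "connected_component_set (- op_spectrum T) z"
  have frontier: "frontier ?C \<subseteq> op_spectrum T"
    using False by (intro frontier_of_components_closed_complement closed_op_spectrum)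
      (auto simp: components_def)
  show ?thesis
  proof (rule maximum_modulus_frontier[of "poly p" ?C])
    show "poly p holomorphic_on interior ?C" "continuous_on (closure ?C) (poly p)"
      by (intro holomorphic_intros continuous_intros)+
    show "cmod (poly p w) \<le> norm (op_poly p T)" if "w \<in> frontier ?C" for w
      using that frontier by (intro norm_poly_spectrum_le[OF T]) auto
    show "bounded ?C"
      using z by (simp add: full_hull_def outside)
    show "z \<in> ?C"
      using False by (simp add: connected_component_refl)
  qed
qed

section \<open>Coefficient bounds and local growth of powers\<close>

lemma norm_coeff_le:
  fixes p :: "complex poly"
  assumes r: "0 < r" and bound: "\<And>z. cmod z = r \<Longrightarrow> cmod (poly p z) \<le> M"
  shows "cmod (coeff p n) \<le> M / r ^ n"
proof -
  have "(deriv ^^ n) (poly p) = poly ((pderiv ^^ n) p)"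
    for n
  proof (induction n)
    case (Suc n)
    have "deriv (poly q) = poly (pderiv q)" for q :: "complex poly"
      by (intro ext DERIV_imp_deriv poly_DERIV)
    with Suc show ?case
      by simp
  qed simp
  \<comment> \<open>At 0 only the constant term of the \<open>n\<close>-th derivative
    survives.\<close>
  then have "(deriv ^^ n) (poly p) 0 = fact n * coeff p n"
    by (simp add: poly_0_coeff_0 coeff_higher_pderiv pochhammer_fact)
  moreover have "cmod ((deriv ^^ n) (poly p) 0) \<le> fact n * M / r ^ n"
  proof (rule Cauchy_inequality)
    show "poly p holomorphic_on ball 0 r" "continuous_on (cball 0 r) (poly p)"
      by (intro holomorphic_intros continuous_intros)+
  qed (use r bound in auto)
  ultimately have "fact n * cmod (coeff p n) \<le> fact n * (M / r ^ n)"
    by (simp add: norm_mult)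
  then show ?thesis
    by (simp only: mult_le_cancel_left_pos fact_gt_zero)
qed

text \<open>A number strictly between the upper limit and \<open>d\<close> eventually bounds the
  roots. It is positive because it exceeds a nonnegative root.\<close>

lemma local_spectral_radius_lessD:
  fixes T :: "'a :: complex_normed_vector \<Rightarrow>\<^sub>L 'a"
  assumes "local_spectral_radius x T < ereal d"
  obtains s where "0 < s" "s < d" "\<forall>\<^sub>F n in sequentially. norm (op_power T n x) \<le> s ^ n"
proof -
  obtain t where t: "local_spectral_radius x T < t" "t < ereal d"
    using assms dense by blast
  then obtain s where s: "t = ereal s"
    by (cases t) auto
  have "\<forall>\<^sub>F n in sequentially. root n (norm (op_power T n x)) < s"
    using Limsup_lessD[OF t(1)[unfolded local_spectral_radius_def]] by (simp add: s)
  \<comment> \<open>Index 0 is excluded because \<open>root 0\<close> is constantly 0 and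
    \<open>root n y ^ n = y\<close> needs \<open>n > 0\<close>.\<close>
  then have ev: "\<forall>\<^sub>F n in sequentially. n > 0 \<and> root n (norm (op_power T n x)) < s"
    by (intro eventually_conj eventually_gt_at_top)
  then obtain n where "n > 0" "root n (norm (op_power T n x)) < s"
    using eventually_happens'[OF sequentially_bot ev] by auto
  then have "0 < s"
    using real_root_ge_zero[OF norm_ge_zero, of n "op_power T n x"] by linarith
  moreover have "\<forall>\<^sub>F n in sequentially. norm (op_power T n x) \<le> s ^ n"
    using ev
  proof eventually_elim
    case (elim n)
    then have "root n (norm (op_power T n x)) ^ n \<le> s ^ n"
      by (intro power_mono) auto
    then show ?case
      using elim by simp
  qed
  moreover have "s < d"
    using t s by simp
  ultimately show ?thesis
    using that by blast
qed

theorem theorem1: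
  fixes T :: "'a :: complex_banach \<Rightarrow>\<^sub>L 'a"
    and S :: "'a set"
  assumes "T \<in> bounded_ops"
    and "0 \<in> interior (full_hull (op_spectrum T))"
    and "spanning_set S"
    and "\<And>x. x \<in> S \<Longrightarrow>
           local_spectral_radius x T
             < ereal (infdist 0 (frontier (full_hull (op_spectrum T))))"
  shows "strongly_compact T"
proof -
  define H where "H = full_hull (op_spectrum T)"
  define B where "B = {R \<in> range (\<lambda>p. op_poly p T). norm R \<le> 1}"
  have orbits_S: "compact (closure ((\<lambda>A. blinfun_apply A x) ` B))" if x: "x \<in> S" for x
  proof -
    obtain s where s: "0 < s" "s < infdist 0 (frontier H)"
      "\<forall>\<^sub>F n in sequentially. norm (op_power T n x) \<le> s ^ n"
      using local_spectral_radius_lessD[OF assms(4)[OF x]] unfolding H_def by blast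
    \<comment> \<open>The lower bound on \<open>r\<close> makes the ratio \<open>s / r\<close> less
      than 1; the upper bound keeps the closed disc of radius \<open>r\<close> off the frontier of
      \<open>H\<close>.\<close>
    obtain r where r: "s < r" "r < infdist 0 (frontier H)"
      using dense[OF s(2)] by blast
    have "cball 0 r \<inter> frontier H = {}"
    proof safe
      fix z assume "z \<in> cball 0 r" "z \<in> frontier H"
      then show "z \<in> {}"
        using r(2) infdist_le[of z "frontier H" 0] by simp
    qed
    moreover have "0 \<in> cball 0 r \<inter> H"
      using r s(1) assms(2) interior_subset by (auto simp: H_def)
    \<comment> \<open>The disc is connected, meets \<open>H\<close> at 0 and misses its frontier, so
      it cannot leave \<open>H\<close>.\<close>
    ultimately have H: "cball 0 r \<subseteq> H"
      using connected_Int_frontier[of "cball 0 r" H] by blast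
    have coeff: "cmod (coeff p i) \<le> 1 / r ^ i" if "norm (op_poly p T) \<le> 1" for p i
    proof (rule norm_coeff_le)
      show "0 < r"
        using r s by simp
      show "cmod (poly p z) \<le> 1" if "cmod z = r" for z
      proof -
        have "z \<in> H"
          using H that by auto
        then show ?thesis
          using norm_poly_full_hull_le[OF assms(1), of z p] \<open>norm (op_poly p T) \<le> 1\<close>
          by (simp add: H_def)
      qed
    qed
    \<comment> \<open>The coefficient bounds are independent of the degree, so one set with
      \<open>m\<close> left free contains the whole orbit.\<close>
    have "(\<lambda>A. blinfun_apply A x) ` B \<subseteq>
        {\<Sum>i\<le>m. a i *\<^sub>C op_power T i x | a m. \<forall>i. cmod (a i) \<le> 1 / r ^ i}"
      (is "_ \<subseteq> ?M")
    proof
      fix y assume "y \<in> (\<lambda>A. blinfun_apply A x) ` B"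
      then obtain p where p: "norm (op_poly p T) \<le> 1" "y = op_poly p T x"
        by (auto simp: B_def)
      have "y = (\<Sum>i\<le>degree p. coeff p i *\<^sub>C op_power T i x)"
        by (simp add: p(2) blinfun_apply_op_poly blinfun_apply_op_power)
      then show "y \<in> ?M"
        using coeff[OF p(1)] by (intro CollectI exI conjI allI)
    qed
    also have "?M \<subseteq> closure ?M"
      by (rule closure_subset)
    finally show ?thesis
      using compact_closure_power_combinations[OF s(1) r(1) s(3)]
      by (rule compact_closure_if_subset_compact[rotated])
  qed
  have orbits: "compact (closure ((\<lambda>A. blinfun_apply A x) ` B))" for x
    by (rule compact_closure_orbits[OF _ _ assms(3) orbits_S])
      (use assms(1) in \<open>auto simp: B_def bounded_opsD op_poly_bounded_ops\<close>)
  have "compactin SOT (SOT closure_of B)"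
    by (rule compactin_SOT_closure[OF _ _ orbits])
      (use assms(1) in \<open>auto simp: B_def op_poly_bounded_ops\<close>)
  then show ?thesis
    by (simp add: strongly_compact_def strongly_compact_algebra_def B_def)
qed

end
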